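(* Let $(X_N)_{N\ge1}$ be a sequence of bounded random variables with values in $\mathbb{N}_0=\{0,1,2,\ldots\}$, with variances $\sigma_N^2>0$ and probability generating functions $f_N(z)=\mathbb{E}[z^{X_N}]$ (which are polynomials). For $N\ge1$ let $\delta_N\in(0,\pi]$ be such that $f_N$ has no roots in the sector $S(\delta_N)$. Put $\Delta_N:=c\,\delta_N\sigma_N$ with the absolute constant $c>0$ of the context, and $X_N^\ast:=(X_N-\mathbb{E}X_N)/\sigma_N$. Let $(a_N)_{N\ge1}$ be a sequence of real numbers with $a_N\to\infty$ and $a_N=o(\Delta_N)$ as $N\to\infty$ (that is, $a_N/\Delta_N\to0$). Then $$\lim_{N\to\infty}\frac{1}{a_N^2}\log\mathbb{P}\big(X_N^\ast/a_N\in(x,\infty)\big)=-\frac{x^2}{2}\qquad\text{for all }x\ge0.$$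
   Context: For $\delta\in(0,\pi]$, $S(\delta):=\{z\in\mathbb{C}\setminus\{0\}:\arg(z)\in(-\delta,\delta)\}$, where $\arg(z)\in(-\pi,\pi]$. The cumulant of order $m$ of a random variable $X$ is denoted $\kappa_m(X)$. The constant $c>0$ is a fixed absolute constant with the following property (such a constant exists, and $c=2^{-3248}$ is admissible): for every bounded $\mathbb{N}_0$-valued random variable $X$ with variance $\sigma^2>0$ whose probability generating function has no roots in $S(\delta)$, where $\delta\in(0,\pi]$, one has $|\kappa_m((X-\mathbb{E}X)/\sigma)|\le m!/(c\,\delta\,\sigma)^{m-2}$ for all integers $m\ge3$. *)

theory Defs
  imports "HOL-Probability.Probability" "HOL-Complex_Analysis.Complex_Analysis"
begin

definition sector :: "real \<Rightarrow> complex set" where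
  "sector \<delta> = {z. z \<noteq> 0 \<and> Arg z \<in> {-\<delta><..<\<delta>}}"

definition bounded_nat_rv :: "'a measure \<Rightarrow> ('a \<Rightarrow> nat) \<Rightarrow> bool" where
  "bounded_nat_rv M X \<longleftrightarrow>
     prob_space M \<and> X \<in> measurable M (count_space UNIV) \<and> (\<exists>B. \<forall>\<omega>\<in>space M. X \<omega> \<le> B)"

definition pgf :: "'a measure \<Rightarrow> ('a \<Rightarrow> nat) \<Rightarrow> complex \<Rightarrow> complex" where
  "pgf M X z = prob_space.expectation M (\<lambda>\<omega>. z ^ X \<omega>)"

definition std_dev :: "'a measure \<Rightarrow> ('a \<Rightarrow> nat) \<Rightarrow> real" where
  "std_dev M X = sqrt (prob_space.variance M (\<lambda>\<omega>. real (X \<omega>)))"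

definition standardized :: "'a measure \<Rightarrow> ('a \<Rightarrow> nat) \<Rightarrow> 'a \<Rightarrow> real" where
  "standardized M X \<omega> = (real (X \<omega>) - prob_space.expectation M (\<lambda>\<omega>. real (X \<omega>))) / std_dev M X"

text \<open>
  The cumulants of \<open>Y\<close> are the derivatives at \<open>0\<close> of its cumulant generating function.
  This is only used for bounded \<open>Y\<close>, where the moment generating function is finite, positive and
  smooth on the whole real line, so that all the derivatives exist.
\<close>
definition cumulant :: "nat \<Rightarrow> 'a measure \<Rightarrow> ('a \<Rightarrow> real) \<Rightarrow> real" where
  "cumulant m M Y =
     (deriv ^^ m) (\<lambda>t. ln (prob_space.expectation M (\<lambda>\<omega>. exp (t * Y \<omega>)))) 0"

text \<open>
  The defining property of the absolute constant. Taking \<open>nat\<close> as the type of the sample space is no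
  restriction: all quantities involved depend only on the law of \<open>X\<close>, and every law on \<open>nat\<close> is that
  of the identity on a probability space over \<open>nat\<close>.
\<close>
definition cumulant_bound_constant :: "real \<Rightarrow> bool" where
  "cumulant_bound_constant c \<longleftrightarrow> c > 0 \<and>
     (\<forall>(M :: nat measure) (X :: nat \<Rightarrow> nat) (\<delta> :: real).
        bounded_nat_rv M X \<longrightarrow> prob_space.variance M (\<lambda>\<omega>. real (X \<omega>)) > 0 \<longrightarrow>
        \<delta> \<in> {0<..pi} \<longrightarrow> (\<forall>z\<in>sector \<delta>. pgf M X z \<noteq> 0) \<longrightarrow>
        (\<forall>m\<ge>3. \<bar>cumulant m M (standardized M X)\<bar> \<le> fact m / (c * \<delta> * std_dev M X) ^ (m - 2)))"

end

theory Submission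
  imports Defs
begin

text \<open>
  By the cumulant bound, the power series with coefficients \<open>\<kappa>\<^sub>m / m!\<close> of the standardized variable
  \<open>Y\<close> converges for \<open>|z| < \<Delta>\<close>, and its exponential is the moment generating function on that whole
  disc by the identity theorem, although the logarithm of the latter is a priori only defined near
  the real axis. Hence \<open>ln E exp (t Y) = t\<^sup>2 / 2 + t\<^sup>2 O(|t| / \<Delta>)\<close> for real \<open>t\<close>, so that
  \<open>ln E exp (a s Y) / a\<^sup>2\<close> tends to \<open>s\<^sup>2 / 2\<close> for \<open>a = o(\<Delta>)\<close>. The tail asymptotics follow as in
  the Gaertner-Ellis theorem: Chernoff's bound from above, and exponential tilting from below.
\<close>

section \<open>From cumulant bounds to the logarithm of the moment generating function\<close>

text \<open>Links the cumulants, which are iterated real derivatives, to the complex Taylor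
  coefficients. In the induction step, the complex derivative is also a derivative along the real
  axis; its imaginary part is the derivative of the zero function and its real part is that of the
  real function.\<close>

lemma higher_deriv_of_real:
  fixes g :: "complex \<Rightarrow> complex" and h :: "real \<Rightarrow> real"
  assumes g: "g holomorphic_on S" "open S"
    and eq: "\<And>t. of_real t \<in> S \<Longrightarrow> g (of_real t) = of_real (h t)"
    and t: "of_real t \<in> S"
  shows "(deriv ^^ n) g (of_real t) = of_real ((deriv ^^ n) h t)"
  using t
proof (induction n arbitrary: t)
  case 0
  then show ?case using eq by simp
next
  case (Suc n)
  let ?g = "(deriv ^^ n) g" and ?h = "(deriv ^^ n) h"
  define d where "d = deriv ?g (of_real t)"
  have "?g holomorphic_on S"
    using g by (rule holomorphic_higher_deriv)
  then have "(?g has_field_derivative d) (at (of_real t))"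
    unfolding d_def using g(2) Suc.prems by (rule holomorphic_derivI)
  then have "((\<lambda>u. ?g (of_real u)) has_vector_derivative d) (at t)"
    by (rule has_vector_derivative_real_field)
  moreover have "open ((of_real :: real \<Rightarrow> complex) -` S)"
    using g(2) by (intro open_vimage continuous_intros)
  ultimately have v: "((\<lambda>u. of_real (?h u) :: complex) has_vector_derivative d) (at t)"
    by (rule has_vector_derivative_transform_within_open) (use Suc in auto)
  have "((\<lambda>u. Re (of_real (?h u))) has_vector_derivative Re d) (at t)"
    by (rule bounded_linear.has_vector_derivative[OF bounded_linear_Re v])
  then have "deriv ?h t = Re d"
    by (simp add: DERIV_imp_deriv has_real_derivative_iff_has_vector_derivative)
  moreover have "((\<lambda>u. Im (of_real (?h u))) has_vector_derivative Im d) (at t)"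
    by (rule bounded_linear.has_vector_derivative[OF bounded_linear_Im v])
  then have "Im d = 0"
    using vector_derivative_unique_at[OF _ has_vector_derivative_const[of 0]] by simp
  ultimately show ?case
    by (simp add: d_def complex_eq_iff)
qed

text \<open>The Taylor terms of order below 3 add up to \<open>t\<^sup>2 / 2\<close>, and the bound
  on the \<open>\<kappa> m\<close> dominates the remaining ones by \<open>t\<^sup>2\<close> times a
  geometric series with ratio \<open>\<bar>t\<bar> / D\<close> that starts at the first power. Zeros
  of \<open>G\<close> in the disc of radius \<open>D\<close> are not excluded beforehand; that there
  are none is a consequence of \<open>expE\<close>.\<close>

lemma log_quadratic_approx:
  fixes G :: "complex \<Rightarrow> complex" and F :: "real \<Rightarrow> real"
  defines "\<kappa> \<equiv> \<lambda>m. (deriv ^^ m) (\<lambda>t. ln (F t)) 0"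
  assumes G: "G holomorphic_on UNIV"
    and GF: "\<And>t. G (of_real t) = of_real (F t)"
    and pos: "\<And>t. F t > 0"
    and k: "\<kappa> 0 = 0" "\<kappa> 1 = 0" "\<kappa> 2 = 1"
    and D: "D > 0"
    and bound: "\<And>m. m \<ge> 3 \<Longrightarrow> \<bar>\<kappa> m\<bar> \<le> fact m / D ^ (m - 2)"
    and t: "\<bar>t\<bar> < D"
  shows "\<bar>ln (F t) - t\<^sup>2 / 2\<bar> \<le> t\<^sup>2 * ((\<bar>t\<bar> / D) / (1 - \<bar>t\<bar> / D))"
proof -
  define b :: "nat \<Rightarrow> complex" where "b = (\<lambda>m. of_real (\<kappa> m) / fact m)"
  define E where "E = eval_fps (Abs_fps b)"
  \<comment> \<open>The factorial cancels, and at \<open>m = n + 3\<close> the power of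
    \<open>D\<close> is \<open>n + 1\<close>. This leaves two factors \<open>norm z\<close> without
    a denominator, hence the quadratic prefactor.\<close>
  have norm_b: "norm (b (n + 3) * z ^ (n + 3)) \<le> (norm z)\<^sup>2 * (norm z / D) * (norm z / D) ^ n" for n z
  proof -
    have "norm (b (n + 3)) \<le> 1 / D ^ (n + 1)"
      using bound[of "n + 3"] D
      by (simp add: b_def norm_divide norm_fact field_simps del: fact_Suc)
    then have "norm (b (n + 3)) * norm z ^ (n + 3) \<le> 1 / D ^ (n + 1) * norm z ^ (n + 3)"
      by (intro mult_right_mono) auto
    also have "\<dots> = (norm z)\<^sup>2 * (norm z / D) * (norm z / D) ^ n"
      using D by (simp add: power_divide power_add power2_eq_square power3_eq_cube field_simps)
    finally show ?thesis by (simp add: norm_mult norm_power)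
  qed
  have geo: "(\<lambda>n. (norm z)\<^sup>2 * (norm z / D) * (norm z / D) ^ n) sums
      ((norm z)\<^sup>2 * (norm z / D) * (1 / (1 - norm z / D)))"
    if "norm z < D" for z :: complex
    using that D by (intro sums_mult geometric_sums) auto
  have summ: "summable (\<lambda>n. norm (b (n + 3) * z ^ (n + 3)))" if "norm z < D" for z
    by (rule summable_comparison_test'[OF sums_summable[OF geo[OF that]], where N = 0])
      (simp only: real_norm_def abs_norm_cancel, rule norm_b)
  have summ': "summable (\<lambda>n. b n * z ^ n)" if "norm z < D" for z
    using summable_norm_cancel[OF summ[OF that]] summable_iff_shift[of "\<lambda>n. b n * z ^ n" 3] by simp
  have rad: "fps_conv_radius (Abs_fps b) \<ge> D"
    unfolding fps_conv_radius_def
    by (rule conv_radius_geI_ex') (use summ' in auto)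
  have E_hol: "E holomorphic_on ball 0 D"
    unfolding E_def using rad
    by (intro holomorphic_intros) (auto simp: less_le_trans[of _ "ereal D"])
  \<comment> \<open>The principal branch makes \<open>Ln (G z)\<close> holomorphic on
    \<open>S\<close>, an open set that contains the real axis because \<open>F\<close> is positive
    there.\<close>
  define S where "S = {z. G z \<notin> \<real>\<^sub>\<le>\<^sub>0}"
  have contG: "continuous_on UNIV G"
    using G by (rule holomorphic_on_imp_continuous_on)
  have "open (G -` (- \<real>\<^sub>\<le>\<^sub>0))"
    using contG by (intro open_vimage) auto
  then have S: "open S" by (simp add: S_def vimage_def)
  have realS: "of_real u \<in> S" for u
    using pos[of u] by (simp add: S_def GF)
  have Ln_hol: "(\<lambda>z. Ln (G z)) holomorphic_on S"
    by (intro holomorphic_on_Ln' holomorphic_on_subset[OF G]) (auto simp: S_def)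
  have derivs: "(deriv ^^ n) (\<lambda>z. Ln (G z)) 0 = of_real (\<kappa> n)" for n
    using higher_deriv_of_real[OF Ln_hol S, of "\<lambda>t. ln (F t)" 0] realS[of 0] pos
    by (simp add: GF Ln_of_real \<kappa>_def)
  obtain r where r: "r > 0" "ball 0 r \<subseteq> S"
    using S realS[of 0] by (auto simp: open_contains_ball)
  define \<rho> where "\<rho> = min r D"
  \<comment> \<open>Near \<open>0\<close> the series \<open>E\<close> is the Taylor series of
    \<open>Ln (G z)\<close>. Further out that logarithm may be undefined, but both sides of the
    exponentiated identity are holomorphic on the whole disc, so they agree there by analytic
    continuation.\<close>
  have expE: "exp (E z) = G z" if "z \<in> ball 0 D" for z
  proof (rule analytic_continuation_open[where s = "ball 0 \<rho>" and s' = "ball 0 D"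
        and f = "\<lambda>z. exp (E z)" and g = G])
    show "exp (E z) = G z" if z: "z \<in> ball 0 \<rho>" for z
    proof -
      have "((\<lambda>n. (deriv ^^ n) (\<lambda>z. Ln (G z)) 0 / fact n * (z - 0) ^ n) sums Ln (G z))"
        by (rule holomorphic_power_series[where r = r])
          (use z r in \<open>auto simp: \<rho>_def intro: holomorphic_on_subset[OF Ln_hol]\<close>)
      then have "E z = Ln (G z)"
        by (simp add: derivs E_def eval_fps_def b_def sums_iff)
      moreover have "z \<in> S" using z r by (auto simp: \<rho>_def)
      then have "G z \<noteq> 0" by (auto simp: S_def)
      ultimately show ?thesis by simp
    qed
    show "ball 0 \<rho> \<noteq> ({} :: complex set)" using r D by (auto simp: \<rho>_def)
    show "(\<lambda>z. exp (E z)) holomorphic_on ball 0 D"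
      using E_hol by (rule holomorphic_on_exp')
    show "G holomorphic_on ball 0 D"
      using G by (rule holomorphic_on_subset) simp
  qed (use that in \<open>auto simp: \<rho>_def\<close>)
  let ?z = "of_real t :: complex"
  \<comment> \<open>Taking norms avoids any question about branches, since
    \<open>ln (norm (exp w)) = Re w\<close>.\<close>
  have "F t = norm (exp (E ?z))"
    using expE[of ?z] t pos[of t] by (simp add: GF)
  then have lnF: "ln (F t) = Re (E ?z)" by simp
  have "E ?z = (\<Sum>n. b (n + 3) * ?z ^ (n + 3)) + (\<Sum>n<3. b n * ?z ^ n)"
    unfolding E_def eval_fps_def fps_nth_Abs_fps
    by (rule suminf_split_initial_segment) (use t summ' in auto)
  also have "(\<Sum>n<3. b n * ?z ^ n) = of_real (t\<^sup>2 / 2)"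
    using k by (simp add: b_def eval_nat_numeral)
  finally have "E ?z - of_real (t\<^sup>2 / 2) = (\<Sum>n. b (n + 3) * ?z ^ (n + 3))" by simp
  also have "norm \<dots> \<le> (\<Sum>n. norm (b (n + 3) * ?z ^ (n + 3)))"
    by (rule summable_norm) (use summ[of ?z] t in auto)
  also have "\<dots> \<le> (norm ?z)\<^sup>2 * (norm ?z / D) * (1 / (1 - norm ?z / D))"
    by (rule suminf_le[OF norm_b summ sums_summable[OF geo], THEN order_trans]) (use geo[of ?z] t in \<open>auto simp: sums_iff\<close>)
  finally have "norm (E ?z - of_real (t\<^sup>2 / 2)) \<le> t\<^sup>2 * ((\<bar>t\<bar> / D) / (1 - \<bar>t\<bar> / D))"
    by simp
  then show ?thesis
    using abs_Re_le_cmod[of "E ?z - of_real (t\<^sup>2 / 2)"] lnF by simp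
qed

section \<open>Exponential bounds for tail probabilities\<close>

context prob_space
begin

lemma chernoff_upper:
  assumes Y: "Y \<in> borel_measurable M" and int: "integrable M (\<lambda>\<omega>. exp (s * Y \<omega>))" and s: "s \<ge> 0"
  shows "prob {\<omega> \<in> space M. Y \<omega> > u} \<le> exp (- (s * u)) * expectation (\<lambda>\<omega>. exp (s * Y \<omega>))"
proof -
  let ?A = "{\<omega> \<in> space M. Y \<omega> > u}"
  have A: "?A \<in> events" using Y by measurable
  then have intA: "integrable M (indicator ?A :: 'a \<Rightarrow> real)"
    by (rule integrable_real_indicator) (simp add: emeasure_eq_measure)
  have "prob ?A = expectation (indicator ?A)" using A by simp
  also have "\<dots> \<le> expectation (\<lambda>\<omega>. exp (- (s * u)) * exp (s * Y \<omega>))"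
  proof (rule integral_mono)
    show "indicator ?A \<omega> \<le> exp (- (s * u)) * exp (s * Y \<omega>)" for \<omega>
      using s by (auto simp: indicator_def mult_left_mono simp flip: exp_add)
  qed (use int intA in auto)
  also have "\<dots> = exp (- (s * u)) * expectation (\<lambda>\<omega>. exp (s * Y \<omega>))" by simp
  finally show ?thesis .
qed

text \<open>
  Under the measure tilted by \<open>exp (s Y)\<close>, the mass is split into the parts \<open>Y \<le> u\<close>, \<open>Y \<ge> w\<close> and
  the rest; the first two are estimated by Chernoff's bound with exponents \<open>-r\<close> and \<open>r\<close>.
\<close>
lemma tilted_lower:
  assumes Y: "Y \<in> borel_measurable M" and int: "\<And>s. integrable M (\<lambda>\<omega>. exp (s * Y \<omega>))"
    and s: "s \<ge> 0" and r: "r \<ge> 0"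
  shows "expectation (\<lambda>\<omega>. exp (s * Y \<omega>)) \<le>
           exp (r * u) * expectation (\<lambda>\<omega>. exp ((s - r) * Y \<omega>)) +
           exp (- (r * w)) * expectation (\<lambda>\<omega>. exp ((s + r) * Y \<omega>)) +
           exp (s * w) * prob {\<omega> \<in> space M. Y \<omega> > u}"
proof -
  let ?A = "{\<omega> \<in> space M. Y \<omega> > u}"
  have A: "?A \<in> events" using Y by measurable
  then have intA: "integrable M (indicator ?A :: 'a \<Rightarrow> real)"
    by (rule integrable_real_indicator) (simp add: emeasure_eq_measure)
  have "expectation (\<lambda>\<omega>. exp (s * Y \<omega>)) \<le>
      expectation (\<lambda>\<omega>. exp (r * u) * exp ((s - r) * Y \<omega>) +
        exp (- (r * w)) * exp ((s + r) * Y \<omega>) + exp (s * w) * indicator ?A \<omega>)"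
  proof (rule integral_mono)
    fix \<omega> assume \<omega>: "\<omega> \<in> space M"
    consider "Y \<omega> \<le> u" | "Y \<omega> \<ge> w" | "u < Y \<omega>" "Y \<omega> < w" by linarith
    then show "exp (s * Y \<omega>) \<le> exp (r * u) * exp ((s - r) * Y \<omega>) +
        exp (- (r * w)) * exp ((s + r) * Y \<omega>) + exp (s * w) * indicator ?A \<omega>"
    proof cases
      case 1
      then have "r * Y \<omega> \<le> r * u" using r by (rule mult_left_mono)
      then have "exp (s * Y \<omega>) \<le> exp (r * u + (s - r) * Y \<omega>)" by (simp add: algebra_simps)
      then show ?thesis by (simp add: exp_add add_increasing2)
    next
      case 2
      then have "r * w \<le> r * Y \<omega>" using r by (rule mult_left_mono)
      then have "exp (s * Y \<omega>) \<le> exp (- (r * w) + (s + r) * Y \<omega>)" by (simp add: algebra_simps)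
      then show ?thesis unfolding exp_add by (intro add_increasing2 add_increasing) auto
    next
      case 3
      then have "s * Y \<omega> \<le> s * w" using s by (intro mult_left_mono) auto
      then show ?thesis using 3 \<omega> by (intro add_increasing) auto
    qed
  qed (use int intA in auto)
  also have "\<dots> = exp (r * u) * expectation (\<lambda>\<omega>. exp ((s - r) * Y \<omega>)) +
           exp (- (r * w)) * expectation (\<lambda>\<omega>. exp ((s + r) * Y \<omega>)) +
           exp (s * w) * prob ?A"
    using int intA A by simp
  finally show ?thesis .
qed

lemma expectation_exp_pos:
  assumes "integrable M (\<lambda>\<omega>. exp (Z \<omega>))"
  shows "expectation (\<lambda>\<omega>. exp (Z \<omega> :: real)) > 0"
proof -
  have "expectation (\<lambda>\<omega>. exp (Z \<omega>)) \<noteq> 0"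
    using assms integral_nonneg_eq_0_iff_AE[of M "\<lambda>\<omega>. exp (Z \<omega>)"] by auto
  moreover have "expectation (\<lambda>\<omega>. exp (Z \<omega>)) \<ge> 0" by simp
  ultimately show ?thesis by linarith
qed

text \<open>Apply \<open>tilted_lower\<close> with the tilt \<open>s = a * (x + \<epsilon>)\<close>,
  under which \<open>Y\<close> should concentrate near \<open>s\<close>, and with
  \<open>r = a * \<epsilon>\<close>. The window is then \<open>a * x\<close> to
  \<open>a * (x + 2 * \<epsilon>)\<close>, whose endpoints are also the exponents
  \<open>s - r\<close> and \<open>s + r\<close> of the two outer terms.\<close>

lemma tail_lower_bound:
  fixes a x \<epsilon> :: real and Y :: "'a \<Rightarrow> real"
  defines "\<Lambda> \<equiv> \<lambda>s. ln (expectation (\<lambda>\<omega>. exp (a * s * Y \<omega>))) / a\<^sup>2"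
  assumes Y: "Y \<in> borel_measurable M" and int: "\<And>s. integrable M (\<lambda>\<omega>. exp (s * Y \<omega>))"
    and a: "a > 0" and x: "x \<ge> 0" and \<epsilon>: "\<epsilon> > 0" and large: "a\<^sup>2 * (\<epsilon>\<^sup>2 / 8) \<ge> 1"
    and \<Lambda>1: "\<Lambda> x \<le> x\<^sup>2 / 2 + \<epsilon>\<^sup>2 / 8"
    and \<Lambda>2: "\<Lambda> (x + \<epsilon>) \<ge> (x + \<epsilon>)\<^sup>2 / 2 - \<epsilon>\<^sup>2 / 8"
    and \<Lambda>3: "\<Lambda> (x + 2 * \<epsilon>) \<le> (x + 2 * \<epsilon>)\<^sup>2 / 2 + \<epsilon>\<^sup>2 / 8"
  shows "prob {\<omega> \<in> space M. Y \<omega> > a * x} \<ge>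
    exp (a\<^sup>2 * ((x + \<epsilon>)\<^sup>2 / 2 - (x + \<epsilon>) * (x + 2 * \<epsilon>) - \<epsilon>\<^sup>2 / 4))"
proof -
  let ?E = "\<lambda>s. expectation (\<lambda>\<omega>. exp (a * s * Y \<omega>))"
  let ?P = "prob {\<omega> \<in> space M. Y \<omega> > a * x}"
  have E: "?E s = exp (a\<^sup>2 * \<Lambda> s)" for s
    using a expectation_exp_pos[OF int, of "a * s"] by (simp add: \<Lambda>_def)
  \<comment> \<open>With \<open>\<Lambda>\<close> exactly quadratic, each outer term would be
    smaller than the total by the factor
    \<open>exp (- (a\<^sup>2 * \<epsilon>\<^sup>2 / 2))\<close>, that is \<open>v\<close> to the
    power -4. The errors of \<open>\<epsilon>\<^sup>2 / 8\<close> in the total and in each outer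
    term cost one factor \<open>v\<close> each, so the total is at least
    \<open>c * v\<^sup>2\<close> and each outer term at most \<open>c\<close>.\<close>
  define v where "v = exp (a\<^sup>2 * (\<epsilon>\<^sup>2 / 8))"
  define c where "c = exp (a\<^sup>2 * ((x + \<epsilon>)\<^sup>2 / 2 - 3 * (\<epsilon>\<^sup>2 / 8)))"
  have v: "v \<ge> 2"
    unfolding v_def using large exp_ge_add_one_self[of "a\<^sup>2 * (\<epsilon>\<^sup>2 / 8)"] by linarith
  have c: "c > 0" by (simp add: c_def)
  have low: "c * v\<^sup>2 \<le> ?E (x + \<epsilon>)"
    unfolding E c_def v_def exp_double[symmetric] exp_add[symmetric]
    using mult_left_mono[OF \<Lambda>2, of "a\<^sup>2"] by (simp add: algebra_simps)
  have e1: "exp (a * \<epsilon> * (a * x)) * ?E x \<le> c"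
    unfolding E c_def exp_add[symmetric]
    using mult_left_mono[OF \<Lambda>1, of "a\<^sup>2"] by (simp add: algebra_simps power2_eq_square)
  have e2: "exp (- (a * \<epsilon> * (a * (x + 2 * \<epsilon>)))) * ?E (x + 2 * \<epsilon>) \<le> c"
    unfolding E c_def exp_add[symmetric]
    using mult_left_mono[OF \<Lambda>3, of "a\<^sup>2"] by (simp add: field_simps power2_eq_square)
  have eqs: "a * (x + \<epsilon>) - a * \<epsilon> = a * x" "a * (x + \<epsilon>) + a * \<epsilon> = a * (x + 2 * \<epsilon>)"
    by (simp_all add: algebra_simps)
  have "?E (x + \<epsilon>) \<le> exp (a * \<epsilon> * (a * x)) * ?E x +
      exp (- (a * \<epsilon> * (a * (x + 2 * \<epsilon>)))) * ?E (x + 2 * \<epsilon>) +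
      exp (a * (x + \<epsilon>) * (a * (x + 2 * \<epsilon>))) * ?P"
    using tilted_lower[OF Y int, of "a * (x + \<epsilon>)" "a * \<epsilon>" "a * x" "a * (x + 2 * \<epsilon>)"] a x \<epsilon>
    unfolding eqs by simp
  with low e1 e2 have "c * v\<^sup>2 - 2 * c \<le> exp (a * (x + \<epsilon>) * (a * (x + 2 * \<epsilon>))) * ?P"
    by linarith
  \<comment> \<open>From \<open>v \<ge> 2\<close> follows \<open>v\<^sup>2 - 2 \<ge> v\<close>, so
    at least \<open>c * v\<close> remains for the window.\<close>
  moreover have "2 * v \<le> v * v" using v by (intro mult_right_mono) auto
  then have "v + 2 \<le> v\<^sup>2" unfolding power2_eq_square using v by linarith
  then have "c * (v + 2) \<le> c * v\<^sup>2" using c by (intro mult_left_mono) auto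
  ultimately have "c * v \<le> exp (a * (x + \<epsilon>) * (a * (x + 2 * \<epsilon>))) * ?P"
    by (simp add: algebra_simps)
  then have "exp (- (a * (x + \<epsilon>) * (a * (x + 2 * \<epsilon>)))) * (c * v) \<le> ?P"
    unfolding exp_minus inverse_eq_divide by (simp add: divide_le_eq mult_ac)
  then show ?thesis
    unfolding c_def v_def exp_add[symmetric] by (simp add: algebra_simps power2_eq_square)
qed

end

section \<open>The limit theorem for quadratic limits of scaled cumulant generating
  functions\<close>

text \<open>The rate is the Legendre transform of \<open>s\<^sup>2 / 2\<close>, whose supremum is
  attained at \<open>s = x\<close>. Limits at \<open>s \<ge> 0\<close> suffice, as the two bounds
  evaluate \<open>\<Lambda>\<close> only at \<open>x\<close>, \<open>x + \<epsilon>\<close> and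
  \<open>x + 2 * \<epsilon>\<close>.\<close>

lemma moderate_deviations:
  fixes M :: "nat \<Rightarrow> 'a measure" and Y :: "nat \<Rightarrow> 'a \<Rightarrow> real" and a :: "nat \<Rightarrow> real"
  assumes M: "\<forall>\<^sub>F N in sequentially. prob_space (M N) \<and> Y N \<in> borel_measurable (M N) \<and>
      (\<forall>s. integrable (M N) (\<lambda>\<omega>. exp (s * Y N \<omega>)))"
    and a: "filterlim a at_top sequentially"
    and lim: "\<And>s. s \<ge> 0 \<Longrightarrow>
      (\<lambda>N. ln (\<integral>\<omega>. exp (a N * s * Y N \<omega>) \<partial>M N) / (a N)\<^sup>2) \<longlonglongrightarrow> s\<^sup>2 / 2"
    and x: "x \<ge> 0"
  shows "(\<lambda>N. ln (measure (M N) {\<omega> \<in> space (M N). Y N \<omega> > a N * x}) / (a N)\<^sup>2)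
    \<longlonglongrightarrow> - (x\<^sup>2 / 2)"
proof -
  define \<Lambda> where "\<Lambda> = (\<lambda>N s. ln (\<integral>\<omega>. exp (a N * s * Y N \<omega>) \<partial>M N) / (a N)\<^sup>2)"
  define P where "P = (\<lambda>N. measure (M N) {\<omega> \<in> space (M N). Y N \<omega> > a N * x})"
  define L where "L = (\<lambda>\<epsilon>. (x + \<epsilon>)\<^sup>2 / 2 - (x + \<epsilon>) * (x + 2 * \<epsilon>) - \<epsilon>\<^sup>2 / 4)"
  have \<Lambda>: "(\<lambda>N. \<Lambda> N s) \<longlonglongrightarrow> s\<^sup>2 / 2" if "s \<ge> 0" for s
    unfolding \<Lambda>_def using lim[OF that] .
  have a2: "filterlim (\<lambda>N. (a N)\<^sup>2) at_top sequentially"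
    using a by (intro filterlim_pow_at_top) auto
  have apos: "\<forall>\<^sub>F N in sequentially. a N > 0"
    using a by (simp add: filterlim_at_top_dense)
  have low: "\<forall>\<^sub>F N in sequentially. P N \<ge> exp ((a N)\<^sup>2 * L \<epsilon>)" if \<epsilon>: "\<epsilon> > 0" for \<epsilon>
  proof -
    have h: "\<epsilon>\<^sup>2 / 8 > 0" using \<epsilon> by simp
    have "\<forall>\<^sub>F N in sequentially. \<Lambda> N x < x\<^sup>2 / 2 + \<epsilon>\<^sup>2 / 8"
      by (rule order_tendstoD(2)[OF \<Lambda>]) (use x h in linarith)+
    moreover have "\<forall>\<^sub>F N in sequentially. \<Lambda> N (x + \<epsilon>) > (x + \<epsilon>)\<^sup>2 / 2 - \<epsilon>\<^sup>2 / 8"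
      by (rule order_tendstoD(1)[OF \<Lambda>]) (use x h \<epsilon> in linarith)+
    moreover have "\<forall>\<^sub>F N in sequentially. \<Lambda> N (x + 2 * \<epsilon>) < (x + 2 * \<epsilon>)\<^sup>2 / 2 + \<epsilon>\<^sup>2 / 8"
      by (rule order_tendstoD(2)[OF \<Lambda>]) (use x h \<epsilon> in linarith)+
    moreover have "\<forall>\<^sub>F N in sequentially. (a N)\<^sup>2 \<ge> 8 / \<epsilon>\<^sup>2"
      using a2 by (simp add: filterlim_at_top)
    ultimately show ?thesis using M apos
    proof eventually_elim
      case (elim N)
      then interpret prob_space "M N" by blast
      show ?case unfolding P_def L_def
        by (rule tail_lower_bound)
          (use elim x \<epsilon> in \<open>auto simp: \<Lambda>_def field_simps\<close>)
    qed
  qed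
  have "(\<lambda>N. ln (P N) / (a N)\<^sup>2) \<longlonglongrightarrow> - (x\<^sup>2 / 2)"
  proof (rule order_tendstoI)
    fix l assume l: "l < - (x\<^sup>2 / 2)"
    \<comment> \<open>The exponent \<open>L \<epsilon>\<close> of the lower bound is continuous in
      \<open>\<epsilon>\<close> and has the desired value at \<open>0\<close>, so one small fixed
      \<open>\<epsilon>\<close> serves for the given \<open>l\<close>.\<close>
    have "(L \<longlongrightarrow> L 0) (at_right 0)"
      unfolding L_def by (intro tendsto_intros) simp_all
    moreover have "L 0 = - (x\<^sup>2 / 2)" by (simp add: L_def power2_eq_square)
    ultimately have "\<forall>\<^sub>F \<epsilon> in at_right 0. L \<epsilon> > l"
      using l by (intro order_tendstoD(1)) auto
    then have "\<forall>\<^sub>F \<epsilon> in at_right 0. L \<epsilon> > l \<and> \<epsilon> > 0"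
      using eventually_at_right_less by (rule eventually_conj)
    then obtain \<epsilon> where \<epsilon>: "L \<epsilon> > l" "\<epsilon> > 0"
      using eventually_happens'[OF trivial_limit_at_right_real] by blast
    show "\<forall>\<^sub>F N in sequentially. l < ln (P N) / (a N)\<^sup>2"
      using low[OF \<epsilon>(2)] apos
    proof eventually_elim
      case (elim N)
      then have "ln (P N) \<ge> (a N)\<^sup>2 * L \<epsilon>"
        by (metis exp_gt_zero ln_exp ln_mono)
      then have "L \<epsilon> \<le> ln (P N) / (a N)\<^sup>2" using elim by (simp add: field_simps)
      with \<epsilon> show ?case by simp
    qed
  next
    fix u assume u: "u > - (x\<^sup>2 / 2)"
    \<comment> \<open>The expression is the Chernoff exponent at the optimal \<open>s = x\<close>,
      divided by \<open>(a N)\<^sup>2\<close>.\<close>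
    have "(\<lambda>N. - x\<^sup>2 + \<Lambda> N x) \<longlonglongrightarrow> - x\<^sup>2 + x\<^sup>2 / 2"
      by (intro tendsto_intros \<Lambda> x)
    then have "\<forall>\<^sub>F N in sequentially. - x\<^sup>2 + \<Lambda> N x < u"
      by (rule order_tendstoD(2)) (use u in simp)
    then show "\<forall>\<^sub>F N in sequentially. ln (P N) / (a N)\<^sup>2 < u"
      \<comment> \<open>The lower bound, here with the arbitrary choice
        \<open>\<epsilon> = 1\<close>, supplies \<open>P N > 0\<close>, which the monotonicity of
        \<open>ln\<close> requires.\<close>
      using low[of 1, simplified] apos M
    proof eventually_elim
      case (elim N)
      then interpret prob_space "M N" by blast
      have Ppos: "P N > 0" using elim by (meson exp_gt_zero less_le_trans)
      have Epos: "expectation (\<lambda>\<omega>. exp (a N * x * Y N \<omega>)) > 0"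
        using elim by (intro expectation_exp_pos) auto
      have "P N \<le> exp (- (a N * x * (a N * x))) * expectation (\<lambda>\<omega>. exp (a N * x * Y N \<omega>))"
        unfolding P_def by (rule chernoff_upper) (use elim x in auto)
      then have "ln (P N) \<le> ln (exp (- (a N * x * (a N * x))) * expectation (\<lambda>\<omega>. exp (a N * x * Y N \<omega>)))"
        using Ppos by (rule ln_mono)
      also have "\<dots> = - (a N * x * (a N * x)) + ln (expectation (\<lambda>\<omega>. exp (a N * x * Y N \<omega>)))"
        using Epos by (simp add: ln_mult)
      finally have "ln (P N) / (a N)\<^sup>2 \<le> - x\<^sup>2 + \<Lambda> N x"
        using elim by (simp add: \<Lambda>_def field_simps power2_eq_square)
      with elim show ?case by simp
    qed
  qed
  then show ?thesis by (simp add: P_def)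
qed

section \<open>Bounded integer-valued variables\<close>

text \<open>As \<open>X\<close> takes finitely many values, \<open>g (X \<omega>)\<close> is a
  finite combination of indicators of level sets. The resulting finite sum is what lets the moment
  generating function extend to an entire function.\<close>

lemma (in prob_space)
  fixes g :: "nat \<Rightarrow> real"
  assumes X: "X \<in> measurable M (count_space UNIV)" and B: "\<And>\<omega>. \<omega> \<in> space M \<Longrightarrow> X \<omega> \<le> B"
  shows integrable_bounded_nat: "integrable M (\<lambda>\<omega>. g (X \<omega>))"
    and expectation_bounded_nat:
      "expectation (\<lambda>\<omega>. g (X \<omega>)) = (\<Sum>k\<le>B. prob {\<omega> \<in> space M. X \<omega> = k} * g k)"
proof -
  have A: "{\<omega> \<in> space M. X \<omega> = k} \<in> events" for k
    using X by measurable
  then have ind: "integrable M (indicator {\<omega> \<in> space M. X \<omega> = k} :: 'a \<Rightarrow> real)" for k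
    by (intro integrable_real_indicator) (simp_all add: emeasure_eq_measure)
  have eq: "g (X \<omega>) = (\<Sum>k\<le>B. indicator {\<omega> \<in> space M. X \<omega> = k} \<omega> * g k)" if "\<omega> \<in> space M" for \<omega>
  proof -
    have "(\<Sum>k\<le>B. indicator {\<omega> \<in> space M. X \<omega> = k} \<omega> * g k) = (\<Sum>k\<le>B. if X \<omega> = k then g k else 0)"
      using that by (intro sum.cong) auto
    then show ?thesis using B[OF that] by simp
  qed
  have "integrable M (\<lambda>\<omega>. \<Sum>k\<le>B. indicator {\<omega> \<in> space M. X \<omega> = k} \<omega> * g k)"
    by (intro Bochner_Integration.integrable_sum integrable_mult_left ind)
  then show "integrable M (\<lambda>\<omega>. g (X \<omega>))"
    by (subst Bochner_Integration.integrable_cong[OF refl eq])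
  have "expectation (\<lambda>\<omega>. g (X \<omega>)) = expectation (\<lambda>\<omega>. \<Sum>k\<le>B. indicator {\<omega> \<in> space M. X \<omega> = k} \<omega> * g k)"
    by (rule Bochner_Integration.integral_cong[OF refl eq])
  also have "\<dots> = (\<Sum>k\<le>B. prob {\<omega> \<in> space M. X \<omega> = k} * g k)"
    using A by (subst Bochner_Integration.integral_sum) (auto intro!: integrable_mult_left ind)
  finally show "expectation (\<lambda>\<omega>. g (X \<omega>)) = (\<Sum>k\<le>B. prob {\<omega> \<in> space M. X \<omega> = k} * g k)" .
qed

lemma standardized_integrable_exp:
  assumes "bounded_nat_rv M X"
  shows "integrable M (\<lambda>\<omega>. exp (s * standardized M X \<omega>))"
proof -
  interpret prob_space M using assms by (simp add: bounded_nat_rv_def)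
  show ?thesis
    using assms integrable_bounded_nat[of X _ "\<lambda>k. exp (s * ((real k - expectation (\<lambda>\<omega>. real (X \<omega>))) / std_dev M X))"]
    by (auto simp: bounded_nat_rv_def standardized_def)
qed

lemma ln_mgf_approx:
  assumes X: "bounded_nat_rv M X" and var: "prob_space.variance M (\<lambda>\<omega>. real (X \<omega>)) > 0"
    and D: "D > 0"
    and bound: "\<And>m. m \<ge> 3 \<Longrightarrow> \<bar>cumulant m M (standardized M X)\<bar> \<le> fact m / D ^ (m - 2)"
    and t: "\<bar>t\<bar> < D"
  shows "\<bar>ln (\<integral>\<omega>. exp (t * standardized M X \<omega>) \<partial>M) - t\<^sup>2 / 2\<bar>
    \<le> t\<^sup>2 * ((\<bar>t\<bar> / D) / (1 - \<bar>t\<bar> / D))"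
proof -
  interpret prob_space M using X by (simp add: bounded_nat_rv_def)
  obtain B where B: "X \<in> measurable M (count_space UNIV)" "\<And>\<omega>. \<omega> \<in> space M \<Longrightarrow> X \<omega> \<le> B"
    using X by (auto simp: bounded_nat_rv_def)
  define \<mu> where "\<mu> = expectation (\<lambda>\<omega>. real (X \<omega>))"
  define \<sigma> where "\<sigma> = std_dev M X"
  define y where "y = (\<lambda>k. (real k - \<mu>) / \<sigma>)"
  define p where "p = (\<lambda>k. prob {\<omega> \<in> space M. X \<omega> = k})"
  have Y: "standardized M X = (\<lambda>\<omega>. y (X \<omega>))"
    by (simp add: standardized_def y_def \<mu>_def \<sigma>_def fun_eq_iff)
  have E: "expectation (\<lambda>\<omega>. g (X \<omega>)) = (\<Sum>k\<le>B. p k * g k)" for g :: "nat \<Rightarrow> real"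
    unfolding p_def by (rule expectation_bounded_nat[OF B])
  have int: "integrable M (\<lambda>\<omega>. g (X \<omega>))" for g :: "nat \<Rightarrow> real"
    by (rule integrable_bounded_nat[OF B])
  define F where "F = (\<lambda>t. \<Sum>k\<le>B. p k * exp (t * y k))"
  \<comment> \<open>\<open>F1\<close> and \<open>F2\<close> are the first two derivatives of
    \<open>F\<close>; at \<open>0\<close> they are the mean and the second moment of the
    standardized variable.\<close>
  define F1 where "F1 = (\<lambda>t. \<Sum>k\<le>B. p k * y k * exp (t * y k))"
  define F2 where "F2 = (\<lambda>t. \<Sum>k\<le>B. p k * (y k)\<^sup>2 * exp (t * y k))"
  have F: "expectation (\<lambda>\<omega>. exp (t * standardized M X \<omega>)) = F t" for t
    unfolding Y F_def by (rule E)
  have pos: "F t > 0" for t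
    unfolding F[symmetric] by (rule expectation_exp_pos) (rule standardized_integrable_exp[OF X])
  have \<sigma>: "\<sigma>\<^sup>2 = expectation (\<lambda>\<omega>. (real (X \<omega>) - \<mu>)\<^sup>2)" "\<sigma> > 0"
    using var by (simp_all add: \<sigma>_def std_dev_def \<mu>_def)
  have F0: "F 0 = 1"
    using F[of 0] by (simp add: prob_space)
  have "F1 0 = expectation (\<lambda>\<omega>. y (X \<omega>))"
    unfolding E by (simp add: F1_def)
  also have "\<dots> = 0"
    using int[of real] by (simp add: y_def prob_space \<mu>_def)
  finally have F10: "F1 0 = 0" .
  have "F2 0 = expectation (\<lambda>\<omega>. (y (X \<omega>))\<^sup>2)"
    using E[of "\<lambda>k. (y k)\<^sup>2"] by (simp add: F2_def)
  also have "\<dots> = 1"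
    using \<sigma>(2) by (simp add: y_def power_divide flip: \<sigma>(1))
  finally have F20: "F2 0 = 1" .
  have dF: "(F has_real_derivative F1 t) (at t)" for t
    unfolding F_def F1_def by (auto intro!: derivative_eq_intros sum.cong)
  have dF1: "(F1 has_real_derivative F2 t) (at t)" for t
    unfolding F1_def F2_def by (auto intro!: derivative_eq_intros sum.cong simp: power2_eq_square)
  have d1: "((\<lambda>t. ln (F t)) has_real_derivative F1 t / F t) (at t)" for t
    using dF pos[of t] by (auto intro!: derivative_eq_intros)
  then have d1': "deriv (\<lambda>t. ln (F t)) = (\<lambda>t. F1 t / F t)"
    by (auto intro: DERIV_imp_deriv)
  \<comment> \<open>The quotient rule gives \<open>(F2 0 * F 0 - F1 0 * F1 0) / (F 0 * F 0)\<close>,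
    and standardization makes this \<open>1\<close>.\<close>
  have "((\<lambda>t. F1 t / F t) has_real_derivative 1) (at 0)"
    using DERIV_divide[OF dF1 dF, of 0] by (simp add: F0 F10 F20)
  then have d2: "deriv (\<lambda>t. F1 t / F t) 0 = 1"
    by (rule DERIV_imp_deriv)
  have cum: "cumulant m M (standardized M X) = (deriv ^^ m) (\<lambda>t. ln (F t)) 0" for m
    by (simp add: cumulant_def F)
  show ?thesis
    unfolding F
  proof (rule log_quadratic_approx[where G = "\<lambda>z. \<Sum>k\<le>B. of_real (p k) * exp (z * of_real (y k))"])
    show "(deriv ^^ 2) (\<lambda>t. ln (F t)) 0 = 1"
      using d1' d2 by (simp add: numeral_2_eq_2)
    show "(\<Sum>k\<le>B. of_real (p k) * exp (of_real t * of_real (y k))) = complex_of_real (F t)" for t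
      by (simp add: F_def exp_of_real flip: of_real_mult)
    show "(\<lambda>z. \<Sum>k\<le>B. of_real (p k) * exp (z * of_real (y k))) holomorphic_on UNIV"
      by (intro holomorphic_intros)
  qed (use pos D bound t F0 F10 d1' in \<open>simp_all add: cum\<close>)
qed

section \<open>Transfer of the cumulant bound, and the moderate deviation limit\<close>

text \<open>The property of \<open>c\<close> speaks of sample spaces over \<open>nat\<close>,
  whereas \<open>M\<close> lives on an arbitrary type. Variance, generating function and cumulants
  are all built from expectations of functions of \<open>X\<close>, so they may be computed under
  the law of \<open>X\<close> on \<open>nat\<close>.\<close>

lemma cumulant_boundD:
  fixes M :: "'a measure"
  assumes c: "cumulant_bound_constant c"
    and X: "bounded_nat_rv M X" and var: "prob_space.variance M (\<lambda>\<omega>. real (X \<omega>)) > 0"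
    and \<delta>: "\<delta> \<in> {0<..pi}" and roots: "\<forall>z\<in>sector \<delta>. pgf M X z \<noteq> 0" and m: "m \<ge> 3"
  shows "\<bar>cumulant m M (standardized M X)\<bar> \<le> fact m / (c * \<delta> * std_dev M X) ^ (m - 2)"
proof -
  interpret prob_space M using X by (simp add: bounded_nat_rv_def)
  obtain B where B: "X \<in> measurable M (count_space UNIV)" "\<And>\<omega>. \<omega> \<in> space M \<Longrightarrow> X \<omega> \<le> B"
    using X by (auto simp: bounded_nat_rv_def)
  \<comment> \<open>The identity is unbounded on the space of \<open>L\<close>, which is all of \<open>nat\<close>, hence the truncation \<open>T\<close>.\<close>
  define L where "L = distr M (count_space UNIV) X"
  define T where "T k = min k B" for k
  interpret L: prob_space L unfolding L_def using B(1) by (rule prob_space_distr)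
  \<comment> \<open>The values of \<open>g\<close> lie in a general Banach space, because the
    generating function needs complex integrands and the variance and cumulants need real
    ones.\<close>
  have E: "L.expectation (\<lambda>k. g (T k)) = expectation (\<lambda>\<omega>. g (X \<omega>))"
    for g :: "nat \<Rightarrow> 'b::{banach,second_countable_topology}"
  proof -
    have "L.expectation (\<lambda>k. g (T k)) = expectation (\<lambda>\<omega>. g (T (X \<omega>)))"
      unfolding L_def using B(1) by (rule integral_distr) simp
    also have "\<dots> = expectation (\<lambda>\<omega>. g (X \<omega>))"
      by (rule Bochner_Integration.integral_cong) (use B(2) in \<open>simp_all add: T_def\<close>)
    finally show ?thesis .
  qed
  have T: "bounded_nat_rv L T"
    unfolding bounded_nat_rv_def
    using L.prob_space_axioms by (auto simp: T_def L_def intro!: exI[of _ B])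
  have v: "L.variance (\<lambda>k. real (T k)) = variance (\<lambda>\<omega>. real (X \<omega>))"
    using E[of "\<lambda>k. (real k - L.expectation (\<lambda>k. real (T k)))\<^sup>2"] E[of real] by simp
  have sd: "std_dev L T = std_dev M X"
    by (simp add: std_dev_def v)
  have "pgf L T z = pgf M X z" for z
    using E[of "\<lambda>k. z ^ k"] by (simp add: pgf_def)
  moreover have "cumulant m L (standardized L T) = cumulant m M (standardized M X)"
    using E[of "\<lambda>k. exp (_ * ((real k - L.expectation (\<lambda>k. real (T k))) / std_dev L T))"] E[of real]
    by (simp add: cumulant_def standardized_def sd)
  ultimately show ?thesis
    using c[unfolded cumulant_bound_constant_def, THEN conjunct2, rule_format, of L T \<delta> m]
      T var \<delta> roots m by (simp add: v sd)
qed

theorem corollary2p3: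
  fixes M :: "nat \<Rightarrow> 'a measure" and X :: "nat \<Rightarrow> 'a \<Rightarrow> nat"
    and \<delta> a :: "nat \<Rightarrow> real" and c :: real
  assumes "cumulant_bound_constant c"
    and "\<And>N. N \<ge> 1 \<Longrightarrow> bounded_nat_rv (M N) (X N)"
    and "\<And>N. N \<ge> 1 \<Longrightarrow> prob_space.variance (M N) (\<lambda>\<omega>. real (X N \<omega>)) > 0"
    and "\<And>N. N \<ge> 1 \<Longrightarrow> \<delta> N \<in> {0<..pi}"
    and "\<And>N. N \<ge> 1 \<Longrightarrow> \<forall>z\<in>sector (\<delta> N). pgf (M N) (X N) z \<noteq> 0"
    and "filterlim a at_top sequentially"
    and "(\<lambda>N. a N / (c * \<delta> N * std_dev (M N) (X N))) \<longlonglongrightarrow> 0"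
  shows "\<forall>x\<ge>0. (\<lambda>N. 1 / (a N)\<^sup>2 *
           ln (measure (M N) {\<omega> \<in> space (M N). standardized (M N) (X N) \<omega> / a N \<in> {x<..}}))
         \<longlonglongrightarrow> - (x\<^sup>2 / 2)"
proof (intro allI impI)
  fix x :: real assume x: "x \<ge> 0"
  define Y where "Y N = standardized (M N) (X N)" for N
  define D where "D N = c * \<delta> N * std_dev (M N) (X N)" for N
  have apos: "\<forall>\<^sub>F N in sequentially. a N > 0"
    using assms(6) by (simp add: filterlim_at_top_dense)
  \<comment> \<open>The index \<open>0\<close> is unconstrained, so everything is shown for
    \<open>N \<ge> 1\<close> and passed on as an eventual statement.\<close>
  have large: "\<forall>\<^sub>F N in sequentially. N \<ge> (1::nat)"
    by (rule eventually_ge_at_top)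
  have D: "D N > 0" if "N \<ge> 1" for N
    using assms(1) assms(3,4)[OF that] by (simp add: D_def cumulant_bound_constant_def std_dev_def)
  have aD: "(\<lambda>N. a N / D N) \<longlonglongrightarrow> 0"
    using assms(7) by (simp add: D_def)
  have "(\<lambda>N. ln (measure (M N) {\<omega> \<in> space (M N). Y N \<omega> > a N * x}) / (a N)\<^sup>2) \<longlonglongrightarrow> - (x\<^sup>2 / 2)"
  proof (rule moderate_deviations)
    show "\<forall>\<^sub>F N in sequentially. prob_space (M N) \<and> Y N \<in> borel_measurable (M N) \<and>
        (\<forall>s. integrable (M N) (\<lambda>\<omega>. exp (s * Y N \<omega>)))"
      using large
    proof eventually_elim
      case (elim N)
      have "X N \<in> measurable (M N) (count_space UNIV)"
        using assms(2)[OF elim] by (simp add: bounded_nat_rv_def)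
      then have "Y N \<in> borel_measurable (M N)"
        unfolding Y_def standardized_def[abs_def] by measurable
      then show ?case
        using assms(2)[OF elim] standardized_integrable_exp
        by (auto simp: Y_def bounded_nat_rv_def)
    qed
    fix s :: real assume s: "s \<ge> 0"
    \<comment> \<open>\<open>q N\<close> is the ratio of the argument \<open>a N * s\<close> to the
      radius \<open>D N\<close>. It tends to \<open>0\<close> by \<open>a = o(\<Delta>)\<close>, and
      with it the relative error \<open>q N / (1 - q N)\<close>.\<close>
    define q where "q N = s * (a N / D N)" for N
    have q: "q \<longlonglongrightarrow> 0"
      unfolding q_def[abs_def] using tendsto_mult_right_zero[OF aD] .
    have "(\<lambda>N. s\<^sup>2 * (q N / (1 - q N))) \<longlonglongrightarrow> s\<^sup>2 * (0 / (1 - 0))"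
      by (intro tendsto_intros q) simp
    then have lim: "(\<lambda>N. s\<^sup>2 * (q N / (1 - q N))) \<longlonglongrightarrow> 0" by simp
    have "\<forall>\<^sub>F N in sequentially. q N < 1"
      using q by (rule order_tendstoD(2)) simp
    then have "\<forall>\<^sub>F N in sequentially.
        norm (ln (\<integral>\<omega>. exp (a N * s * Y N \<omega>) \<partial>M N) / (a N)\<^sup>2 - s\<^sup>2 / 2) \<le> s\<^sup>2 * (q N / (1 - q N))"
      using apos large
    proof eventually_elim
      case (elim N)
      let ?l = "ln (\<integral>\<omega>. exp (a N * s * Y N \<omega>) \<partial>M N)"
      note N = elim(3)
      have q': "\<bar>a N * s\<bar> / D N = q N" using elim s D[OF N] by (simp add: q_def)
      then have "\<bar>a N * s\<bar> < D N" using elim D[OF N] by (simp add: field_simps)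
      \<comment> \<open>The error bound carries the factor \<open>(a N * s)\<^sup>2\<close>, so that
        division by \<open>(a N)\<^sup>2\<close> leaves an error that vanishes in the limit.\<close>
      then have "\<bar>?l - (a N * s)\<^sup>2 / 2\<bar> \<le> (a N * s)\<^sup>2 * (q N / (1 - q N))"
        unfolding Y_def q'[symmetric]
        using cumulant_boundD[OF assms(1) assms(2-5)[OF N]] D[OF N]
        by (intro ln_mgf_approx[OF assms(2,3)[OF N]]) (auto simp: D_def)
      moreover have "?l / (a N)\<^sup>2 - s\<^sup>2 / 2 = (?l - (a N * s)\<^sup>2 / 2) / (a N)\<^sup>2"
        using elim by (simp add: field_simps)
      ultimately show ?case
        using elim by (simp add: abs_divide pos_divide_le_eq power_mult_distrib mult_ac)
    qed
    then have "(\<lambda>N. ln (\<integral>\<omega>. exp (a N * s * Y N \<omega>) \<partial>M N) / (a N)\<^sup>2 - s\<^sup>2 / 2) \<longlonglongrightarrow> 0"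
      using lim by (rule Lim_null_comparison)
    then show "(\<lambda>N. ln (\<integral>\<omega>. exp (a N * s * Y N \<omega>) \<partial>M N) / (a N)\<^sup>2) \<longlonglongrightarrow> s\<^sup>2 / 2"
      by (simp add: LIM_zero_iff)
  qed (use assms x in auto)
  then show "(\<lambda>N. 1 / (a N)\<^sup>2 *
      ln (measure (M N) {\<omega> \<in> space (M N). standardized (M N) (X N) \<omega> / a N \<in> {x<..}}))
      \<longlonglongrightarrow> - (x\<^sup>2 / 2)"
  proof (rule Lim_transform_eventually)
    show "\<forall>\<^sub>F N in sequentially.
        ln (measure (M N) {\<omega> \<in> space (M N). Y N \<omega> > a N * x}) / (a N)\<^sup>2 =
        1 / (a N)\<^sup>2 * ln (measure (M N) {\<omega> \<in> space (M N). standardized (M N) (X N) \<omega> / a N \<in> {x<..}})"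
      using apos
    proof eventually_elim
      case (elim N)
      then have "{\<omega> \<in> space (M N). standardized (M N) (X N) \<omega> / a N \<in> {x<..}} =
          {\<omega> \<in> space (M N). Y N \<omega> > a N * x}"
        by (auto simp: Y_def pos_less_divide_eq mult.commute)
      then show ?case by simp
    qed
  qed
qed

end
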